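(* Let $\mathbf{B}$ and $\mathbf{C}$ be categories, let $B\in\mathrm{Ob}(\mathbf{B})$ and $C\in\mathrm{Ob}(\mathbf{C})$, and assume there is a forgetful functor $U:\overline{\mathrm{Age}}_{\mathbf{B}}(B)\to\overline{\mathrm{Age}}_{\mathbf{C}}(C)$ such that: (i) $U(B)=C$; (ii) if $B'\in\mathrm{Ob}(\overline{\mathrm{Age}}_{\mathbf{B}}(B))$ and $U(B')=C$, then $\hom_{\mathbf{B}}(B,B')\neq\varnothing$; (iii) for every $f\in\hom_{\mathbf{C}}(C,C)$ there is $B'\in\mathrm{Ob}(\overline{\mathrm{Age}}_{\mathbf{B}}(B))$ with $U(B')=C$ and $f\in\hom_{\mathbf{B}}(B',B)$. Then $T_{\mathbf{B}}(A,B)\le T_{\mathbf{C}}(U(A),C)$ for every $A\in\mathrm{Ob}(\overline{\mathrm{Age}}_{\mathbf{B}}(B))$.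
   Context: For a category $\mathbf{C}$ and $C\in\mathrm{Ob}(\mathbf{C})$, $\overline{\mathrm{Age}}_{\mathbf{C}}(C)$ is the full subcategory of $\mathbf{C}$ spanned by all objects $A$ with $\hom_{\mathbf{C}}(A,C)\neq\varnothing$. A functor $U$ is forgetful if it is injective on hom-sets, i.e. $h\mapsto U(h)$ is injective from $\hom(A,A')$ to $\hom(U(A),U(A'))$; one then identifies $h$ with $U(h)$, so that $\hom_{\mathbf{B}}(A,A')\subseteq\hom_{\mathbf{C}}(U(A),U(A'))$ (this identification is used in (iii)). Write $C\longrightarrow(B)^A_{k,t}$ if for every map $\chi:\hom(A,C)\to\{0,\dots,k-1\}$ there is $w\in\hom(B,C)$ with $|\chi(w\cdot\hom(A,B))|\le t$. For $A$ with $\hom(A,C)\neq\varnothing$, $T(A,C)$ (the big Ramsey degree, computed in the indicated category) is the least positive integer $t$ such that $C\longrightarrow(C)^A_{k,t}$ for all integers $k\ge2$, and $\infty$ if none exists; $\infty\le\infty$ by convention. *)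

theory Defs
  imports Main "HOL-Library.FuncSet" "HOL-Library.Extended_Nat"
begin

record ('o, 'm) cat =
  Obj :: "'o set"
  Arr :: "'m set"
  Dom :: "'m \<Rightarrow> 'o"
  Cod :: "'m \<Rightarrow> 'o"
  Ident :: "'o \<Rightarrow> 'm"
  Comp :: "'m \<Rightarrow> 'm \<Rightarrow> 'm"

definition Hom :: "('o, 'm) cat \<Rightarrow> 'o \<Rightarrow> 'o \<Rightarrow> 'm set" where
  "Hom \<C> A B = {f \<in> Arr \<C>. Dom \<C> f = A \<and> Cod \<C> f = B}"

text \<open>\<open>Comp \<C> g f\<close> is the composite \<open>g \<cdot> f\<close> (first \<open>f\<close>, then \<open>g\<close>); it is meaningful
  only for arrows with \<open>Cod \<C> f = Dom \<C> g\<close>.\<close>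

locale category =
  fixes \<C> :: "('o, 'm) cat"
  assumes Dom_in_Obj: "f \<in> Arr \<C> \<Longrightarrow> Dom \<C> f \<in> Obj \<C>"
    and Cod_in_Obj: "f \<in> Arr \<C> \<Longrightarrow> Cod \<C> f \<in> Obj \<C>"
    and Ident_in_Hom: "A \<in> Obj \<C> \<Longrightarrow> Ident \<C> A \<in> Hom \<C> A A"
    and Comp_in_Hom: "f \<in> Hom \<C> A B \<Longrightarrow> g \<in> Hom \<C> B D \<Longrightarrow> Comp \<C> g f \<in> Hom \<C> A D"
    and Comp_Ident_right: "f \<in> Hom \<C> A B \<Longrightarrow> Comp \<C> f (Ident \<C> A) = f"
    and Comp_Ident_left: "f \<in> Hom \<C> A B \<Longrightarrow> Comp \<C> (Ident \<C> B) f = f"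
    and Comp_assoc:
      "f \<in> Hom \<C> A B \<Longrightarrow> g \<in> Hom \<C> B D \<Longrightarrow> h \<in> Hom \<C> D E \<Longrightarrow>
        Comp \<C> (Comp \<C> h g) f = Comp \<C> h (Comp \<C> g f)"

definition full_subcategory :: "('o, 'm) cat \<Rightarrow> 'o set \<Rightarrow> ('o, 'm) cat" where
  "full_subcategory \<C> S =
    \<C>\<lparr>Obj := Obj \<C> \<inter> S, Arr := {f \<in> Arr \<C>. Dom \<C> f \<in> S \<and> Cod \<C> f \<in> S}\<rparr>"

definition age :: "('o, 'm) cat \<Rightarrow> 'o \<Rightarrow> ('o, 'm) cat" where
  "age \<C> C = full_subcategory \<C> {A \<in> Obj \<C>. Hom \<C> A C \<noteq> {}}"

lemma Hom_full_subcategory: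
  "Hom (full_subcategory \<C> S) A B = (if A \<in> S \<and> B \<in> S then Hom \<C> A B else {})"
  by (auto simp: Hom_def full_subcategory_def)

lemma full_subcategory_simps:
  "Obj (full_subcategory \<C> S) = Obj \<C> \<inter> S"
  "Arr (full_subcategory \<C> S) = {f \<in> Arr \<C>. Dom \<C> f \<in> S \<and> Cod \<C> f \<in> S}"
  "Dom (full_subcategory \<C> S) = Dom \<C>"
  "Cod (full_subcategory \<C> S) = Cod \<C>"
  "Ident (full_subcategory \<C> S) = Ident \<C>"
  "Comp (full_subcategory \<C> S) = Comp \<C>"
  by (simp_all add: full_subcategory_def)

lemma category_full_subcategory:
  assumes "category \<C>"
  shows "category (full_subcategory \<C> S)"
proof -
  interpret category \<C> by fact
  show ?thesis
    by unfold_locales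
      (auto simp: full_subcategory_simps Hom_full_subcategory split: if_splits
        intro: Dom_in_Obj Cod_in_Obj Ident_in_Hom Comp_in_Hom
          Comp_Ident_right Comp_Ident_left Comp_assoc)
qed

lemma category_age: "category \<C> \<Longrightarrow> category (age \<C> C)"
  by (simp add: age_def category_full_subcategory)

text \<open>A functor is given by its object map \<open>Fo\<close> and its arrow map \<open>Fa\<close>.\<close>

locale category_functor =
  source: category \<A> + target: category \<B>
  for \<A> :: "('o, 'm) cat" and \<B> :: "('p, 'n) cat"
    and Fo :: "'o \<Rightarrow> 'p" and Fa :: "'m \<Rightarrow> 'n" +
  assumes Fo_in_Obj: "A \<in> Obj \<A> \<Longrightarrow> Fo A \<in> Obj \<B>"
    and Fa_in_Hom: "f \<in> Hom \<A> A A' \<Longrightarrow> Fa f \<in> Hom \<B> (Fo A) (Fo A')"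
    and Fa_Ident: "A \<in> Obj \<A> \<Longrightarrow> Fa (Ident \<A> A) = Ident \<B> (Fo A)"
    and Fa_Comp: "f \<in> Hom \<A> A A' \<Longrightarrow> g \<in> Hom \<A> A' A'' \<Longrightarrow>
        Fa (Comp \<A> g f) = Comp \<B> (Fa g) (Fa f)"

locale forgetful_functor = category_functor +
  assumes inj_on_Hom: "A \<in> Obj \<A> \<Longrightarrow> A' \<in> Obj \<A> \<Longrightarrow> inj_on Fa (Hom \<A> A A')"

text \<open>\<open>ramsey_arrow \<C> C B A k t\<close> is \<open>C \<longrightarrow> (B)\<close> with superscript \<open>A\<close> and
  subscript \<open>k, t\<close>.\<close>

definition ramsey_arrow :: "('o, 'm) cat \<Rightarrow> 'o \<Rightarrow> 'o \<Rightarrow> 'o \<Rightarrow> nat \<Rightarrow> nat \<Rightarrow> bool" where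
  "ramsey_arrow \<C> C B A k t \<longleftrightarrow>
    (\<forall>\<chi> \<in> Hom \<C> A C \<rightarrow> {..<k}. \<exists>w \<in> Hom \<C> B C. card (\<chi> ` Comp \<C> w ` Hom \<C> A B) \<le> t)"

definition big_ramsey_bound :: "('o, 'm) cat \<Rightarrow> 'o \<Rightarrow> 'o \<Rightarrow> nat \<Rightarrow> bool" where
  "big_ramsey_bound \<C> A C t \<longleftrightarrow> t \<ge> 1 \<and> (\<forall>k\<ge>2. ramsey_arrow \<C> C C A k t)"

definition big_ramsey_degree :: "('o, 'm) cat \<Rightarrow> 'o \<Rightarrow> 'o \<Rightarrow> enat" where
  "big_ramsey_degree \<C> A C =
    (if \<exists>t. big_ramsey_bound \<C> A C t then enat (LEAST t. big_ramsey_bound \<C> A C t) else \<infinity>)"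

end

theory Submission
  imports Defs
begin

text \<open>A coloring of \<open>hom(A, B)\<close> transfers along the injective \<open>U\<close> to \<open>hom(U A, C)\<close>, and some
  \<open>w : C \<rightarrow> C\<close> attains few colors there. By (iii) \<open>w\<close> lifts to an arrow \<open>v : B' \<rightarrow> B\<close> with
  \<open>U B' = C\<close>, and by (ii) there is \<open>g : B \<rightarrow> B'\<close>; then \<open>v \<cdot> g\<close> attains no color
  on \<open>hom(A, B)\<close> that \<open>w\<close> does not attain on \<open>hom(U A, C)\<close>.\<close>

lemma Obj_age: "A \<in> Obj (age \<C> C) \<longleftrightarrow> A \<in> Obj \<C> \<and> Hom \<C> A C \<noteq> {}"
  by (auto simp: age_def full_subcategory_simps)

lemma Hom_age:
  "A \<in> Obj (age \<C> C) \<Longrightarrow> A' \<in> Obj (age \<C> C) \<Longrightarrow> Hom (age \<C> C) A A' = Hom \<C> A A'"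
  by (simp add: age_def Hom_full_subcategory full_subcategory_simps)

lemma Hom_age_subset: "Hom (age \<C> C) A A' \<subseteq> Hom \<C> A A'"
  by (simp add: age_def Hom_full_subcategory)

lemma Comp_age: "Comp (age \<C> C) = Comp \<C>"
  by (simp add: age_def full_subcategory_simps)

lemma (in category) self_in_age: "C \<in> Obj \<C> \<Longrightarrow> C \<in> Obj (age \<C> C)"
  using Ident_in_Hom by (auto simp: Obj_age)

text \<open>If the right side has no bound, its degree is \<infinity>; otherwise its least bound is
  also a bound on the left, hence at least the left minimum.\<close>

lemma big_ramsey_degree_mono:
  assumes "\<And>t. big_ramsey_bound \<D> A' D t \<Longrightarrow> big_ramsey_bound \<C> A C t"
  shows "big_ramsey_degree \<C> A C \<le> big_ramsey_degree \<D> A' D"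
  using assms by (auto simp: big_ramsey_degree_def intro: Least_le LeastI)

lemma ramsey_arrow_lift:
  assumes "category \<B>" and "B \<in> Obj \<B>"
    and "forgetful_functor (age \<B> B) (age \<C> C) Uo Ua"
    and return: "\<And>B'. B' \<in> Obj (age \<B> B) \<Longrightarrow> Uo B' = C \<Longrightarrow> Hom \<B> B B' \<noteq> {}"
    and lift: "\<And>f. f \<in> Hom \<C> C C \<Longrightarrow>
          \<exists>B' \<in> Obj (age \<B> B). Uo B' = C \<and> f \<in> Ua ` Hom \<B> B' B"
    and A: "A \<in> Obj (age \<B> B)"
    and "0 < k" and arrow: "ramsey_arrow \<C> C C (Uo A) k t"
  shows "ramsey_arrow \<B> B B A k t"
  unfolding ramsey_arrow_def
proof
  fix \<chi> assume \<chi>: "\<chi> \<in> Hom \<B> A B \<rightarrow> {..<k}"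
  interpret category \<B> by fact
  interpret U: forgetful_functor "age \<B> B" "age \<C> C" Uo Ua by fact
  have B: "B \<in> Obj (age \<B> B)"
    using self_in_age \<open>B \<in> Obj \<B>\<close> .
  have inj: "inj_on Ua (Hom \<B> A B)"
    using U.inj_on_Hom[OF A B] by (simp add: Hom_age A B)
  \<comment> \<open>Injectivity makes \<open>inv_into\<close> recover the arrow whose color is
    copied. Off the image the default 0 is a legal color because \<open>0 < k\<close>.\<close>
  define \<psi> where
    "\<psi> y = (if y \<in> Ua ` Hom \<B> A B then \<chi> (inv_into (Hom \<B> A B) Ua y) else 0)" for y
  have \<psi>_Ua: "\<psi> (Ua h) = \<chi> h" if "h \<in> Hom \<B> A B" for h
    using that inj by (simp add: \<psi>_def)
  have \<psi>: "\<psi> y < k" for y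
    using \<chi> \<open>0 < k\<close> by (auto simp: \<psi>_def Pi_iff intro: inv_into_into)
  obtain w where w: "w \<in> Hom \<C> C C"
    and card_w: "card (\<psi> ` Comp \<C> w ` Hom \<C> (Uo A) C) \<le> t"
    using arrow \<psi> unfolding ramsey_arrow_def by blast
  obtain B' v where B': "B' \<in> Obj (age \<B> B)" and UB': "Uo B' = C"
    and v: "v \<in> Hom \<B> B' B" and wv: "w = Ua v"
    using lift[OF w] by blast
  \<comment> \<open>\<open>B'\<close> need not be \<open>B\<close>, so \<open>v\<close> alone need
    not be an endomorphism of \<open>B\<close>; precomposing with \<open>g\<close> corrects its
    domain.\<close>
  obtain g where g: "g \<in> Hom \<B> B B'"
    using return[OF B' UB'] by blast
  \<comment> \<open>By associativity \<open>h\<close> can be absorbed into \<open>g\<close> first.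
    The resulting arrow ends in \<open>B'\<close>, and since \<open>Uo B' = C\<close> its image is
    one of the arrows that \<open>w\<close> is composed with.\<close>
  have "\<chi> (Comp \<B> (Comp \<B> v g) h) \<in> \<psi> ` Comp \<C> w ` Hom \<C> (Uo A) C"
    if h: "h \<in> Hom \<B> A B" for h
  proof -
    have gh: "Comp \<B> g h \<in> Hom \<B> A B'"
      using Comp_in_Hom[OF h g] .
    have "Ua (Comp \<B> g h) \<in> Hom \<C> (Uo A) C"
      using U.Fa_in_Hom[of "Comp \<B> g h" A B'] gh UB'
      by (simp add: Hom_age A B' subsetD[OF Hom_age_subset])
    moreover have "Ua (Comp \<B> v (Comp \<B> g h)) = Comp \<C> w (Ua (Comp \<B> g h))"
      using U.Fa_Comp[of "Comp \<B> g h" A B' v B] gh v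
      by (simp add: Hom_age A B B' Comp_age wv)
    moreover have "\<chi> (Comp \<B> (Comp \<B> v g) h) = \<psi> (Ua (Comp \<B> v (Comp \<B> g h)))"
      using \<psi>_Ua[OF Comp_in_Hom[OF gh v]] Comp_assoc[OF h g v] by simp
    ultimately show ?thesis by auto
  qed
  then have "\<chi> ` Comp \<B> (Comp \<B> v g) ` Hom \<B> A B \<subseteq> \<psi> ` Comp \<C> w ` Hom \<C> (Uo A) C"
    by blast
  \<comment> \<open>An infinite set has \<open>card\<close> 0, so the inclusion bounds cardinalities
    only because the colors lie below \<open>k\<close>.\<close>
  moreover have "finite (\<psi> ` Comp \<C> w ` Hom \<C> (Uo A) C)"
    using \<psi> by (intro finite_subset[OF _ finite_lessThan[of k]]) auto
  ultimately have "card (\<chi> ` Comp \<B> (Comp \<B> v g) ` Hom \<B> A B) \<le> t"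
    using card_w by (meson card_mono le_trans)
  then show "\<exists>w \<in> Hom \<B> B B. card (\<chi> ` Comp \<B> w ` Hom \<B> A B) \<le> t"
    using Comp_in_Hom[OF g v] by blast
qed

theorem theorem3p8:
  fixes \<B> :: "('o, 'm) cat" and \<C> :: "('p, 'n) cat"
    and B :: 'o and C :: 'p
    and Uo :: "'o \<Rightarrow> 'p" and Ua :: "'m \<Rightarrow> 'n"
  assumes "category \<B>" and "category \<C>"
    and "B \<in> Obj \<B>" and "C \<in> Obj \<C>"
    and "forgetful_functor (age \<B> B) (age \<C> C) Uo Ua"
    and "Uo B = C"
    and "\<And>B'. B' \<in> Obj (age \<B> B) \<Longrightarrow> Uo B' = C \<Longrightarrow> Hom \<B> B B' \<noteq> {}"
    and "\<And>f. f \<in> Hom \<C> C C \<Longrightarrow>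
          \<exists>B' \<in> Obj (age \<B> B). Uo B' = C \<and> f \<in> Ua ` Hom \<B> B' B"
  shows "\<forall>A \<in> Obj (age \<B> B). big_ramsey_degree \<B> A B \<le> big_ramsey_degree \<C> (Uo A) C"
proof
  fix A assume "A \<in> Obj (age \<B> B)"
  \<comment> \<open>The same \<open>t\<close> is kept for each \<open>k\<close>, so a bound uniform
    in \<open>k\<close> stays uniform.\<close>
  then have "ramsey_arrow \<B> B B A k t"
    if "2 \<le> k" "ramsey_arrow \<C> C C (Uo A) k t" for k t
    using ramsey_arrow_lift[OF assms(1,3,5,7,8)] that by simp
  then show "big_ramsey_degree \<B> A B \<le> big_ramsey_degree \<C> (Uo A) C"
    by (intro big_ramsey_degree_mono) (simp add: big_ramsey_bound_def)
qed

end
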